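(* Let $n \ge 7$ be an integer. Then the size-Ramsey number of the $3$-uniform tight path on $n$ vertices satisfies $$\hat{R}^{(3)}\big(P^{(3)}_{n,2}\big) \ge \tfrac{8}{3} n - \tfrac{28}{3}.$$
   Context: A $k$-graph is a $k$-uniform hypergraph $G=(V,E)$ with $E\subseteq\binom{V}{k}$. A ($2$-edge) coloring of a $k$-graph $G$ is any function $c\colon E(G)\to\{\text{red},\text{blue}\}$. For $k$-graphs $G,H$ we write $G\rightarrow H$ if every coloring of $G$ contains a monochromatic copy of $H$ (a subhypergraph isomorphic to $H$ all of whose edges have the same color). The size-Ramsey number of a $k$-graph $H$ is $\hat{R}^{(k)}(H)=\min\{m\in\mathbb{N}: \text{there is a } k\text{-graph } G \text{ with } |E(G)|=m \text{ and } G\rightarrow H\}$. For $k\ge 2$ and $n\ge k$, the $k$-uniform tight path on $n$ vertices, $P^{(k)}_{n,k-1}$, is the $k$-graph on $n$ vertices for which there is an ordering $v_1,\dots,v_n$ of its vertices such that its edges are exactly the sets $\{v_j,v_{j+1},\dots,v_{j+k-1}\}$ for $1\le j\le n-k+1$. *)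

theory Defs
  imports Complex_Main "HOL-Library.Ramsey"
begin

type_synonym 'a hypergraph = "'a set \<times> 'a set set"

abbreviation verts :: "'a hypergraph \<Rightarrow> 'a set" where
  "verts G \<equiv> fst G"

abbreviation edges :: "'a hypergraph \<Rightarrow> 'a set set" where
  "edges G \<equiv> snd G"

definition kgraph :: "nat \<Rightarrow> 'a hypergraph \<Rightarrow> bool" where
  "kgraph k G \<longleftrightarrow> finite (verts G) \<and> edges G \<subseteq> nsets (verts G) k"

definition subhypergraph :: "'a hypergraph \<Rightarrow> 'a hypergraph \<Rightarrow> bool" where
  "subhypergraph S G \<longleftrightarrow> verts S \<subseteq> verts G \<and> edges S \<subseteq> edges G"

definition isomorphic :: "'a hypergraph \<Rightarrow> 'b hypergraph \<Rightarrow> bool" where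
  "isomorphic H S \<longleftrightarrow>
     (\<exists>f. bij_betw f (verts H) (verts S) \<and> (\<lambda>e. f ` e) ` edges H = edges S)"

datatype color = Red | Blue

text \<open>A coloring is represented by a total function on sets; only its values on the edges
  of \<open>G\<close> matter.\<close>

definition arrows :: "'a hypergraph \<Rightarrow> 'b hypergraph \<Rightarrow> bool" where
  "arrows G H \<longleftrightarrow>
     (\<forall>c :: 'a set \<Rightarrow> color. \<exists>S col.
        subhypergraph S G \<and> isomorphic H S \<and> (\<forall>e\<in>edges S. c e = col))"

text \<open>Host hypergraphs live on natural numbers, which loses no generality: every finite
  hypergraph is isomorphic to one of these. On \<open>nat\<close>, \<open>Inf\<close> of a nonempty set is its minimum;
  nonemptiness for finite \<open>k\<close>-graphs \<open>H\<close> is Ramsey's theorem, and \<open>Inf {}\<close> would be \<open>0\<close>.\<close>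

definition size_ramsey :: "nat \<Rightarrow> 'b hypergraph \<Rightarrow> nat" where
  "size_ramsey k H =
     Inf {m. \<exists>G :: nat hypergraph. kgraph k G \<and> card (edges G) = m \<and> arrows G H}"

text \<open>The vertices are \<open>1, \<dots>, n\<close> in their natural order. The edge condition \<open>j + k \<le> n + 1\<close>
  is \<open>j \<le> n - k + 1\<close> without truncated subtraction.\<close>

definition tight_path :: "nat \<Rightarrow> nat \<Rightarrow> nat hypergraph" where
  "tight_path k n = ({1..n}, {{j..j + k - 1} | j. 1 \<le> j \<and> j + k \<le> n + 1})"

lemma kgraph_tight_path: "kgraph k (tight_path k n)"
  by (auto simp: kgraph_def tight_path_def nsets_def)

end

theory Submission
  imports Defs
begin

text \<open>If \<open>F\<close> is a path-free set of edges of \<open>G\<close>, colouring \<open>F\<close> against its complement shows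
  \<open>|E(G)| \<ge> |F| + (n - 2)\<close>, so it suffices to find such an \<open>F\<close> with about \<open>5n/3\<close> edges.
  Let \<open>X\<close> consist of \<open>n - 4\<close> consecutive vertices of a path in \<open>G\<close> and let \<open>P\<close> be the edges of that
  path inside \<open>X\<close>. Colour an edge \<open>e\<close> by the parity of \<open>|e \<inter> X|\<close>. This number changes by at
  most one between consecutive edges of a path, so it is constant, say \<open>c\<close>, on a monochromatic
  path \<open>q\<close>, and \<open>c \<noteq> 3\<close> as \<open>X\<close> is too small. If \<open>c \<le> 1\<close>, no path can switch between \<open>P\<close> and
  the edges of \<open>q\<close>, so dropping one edge of \<open>q\<close> makes the union path-free. If \<open>c = 2\<close>, dropping
  every third edge of \<open>q\<close> prevents paths from passing through vertices outside \<open>X\<close>.\<close>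

section \<open>Edges of a tight path as windows of a vertex sequence\<close>

definition window :: "(nat \<Rightarrow> 'a) \<Rightarrow> nat \<Rightarrow> 'a set" where
  "window p i = {p i, p (i + 1), p (i + 2)}"

text \<open>Positions count from 0. Only edges are recorded: for \<open>n \<ge> 3\<close> every
  vertex of the path lies in one of them.\<close>

definition has_path :: "nat \<Rightarrow> 'a set set \<Rightarrow> bool" where
  "has_path n E \<longleftrightarrow> (\<exists>p. inj_on p {..<n} \<and> window p ` {..<n - 2} \<subseteq> E)"

lemma window_eq_image: "window p i = p ` {i, i + 1, i + 2}"
  by (simp add: window_def)

lemma inj_on_window:
  assumes "inj_on p {..<n}"
  shows "inj_on (window p) {..<n - 2}"
proof (rule inj_onI)
  fix i j assume ij: "i \<in> {..<n - 2}" "j \<in> {..<n - 2}" and eq: "window p i = window p j"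
  have "{i, i + 1, i + 2} \<subseteq> {..<n}" "{j, j + 1, j + 2} \<subseteq> {..<n}" using ij by auto
  then have "{i, i + 1, i + 2} = {j, j + 1, j + 2}"
    using inj_on_image_eq_iff[OF assms] eq unfolding window_eq_image by blast
  then have "Min {i, i + 1, i + 2} = Min {j, j + 1, j + 2}" by simp
  then show "i = j" by simp
qed

lemma card_windows:
  assumes "inj_on p {..<n}"
  shows "card (window p ` {..<n - 2}) = n - 2"
  using card_image[OF inj_on_window[OF assms]] by simp

lemma card_window_Int:
  assumes "inj_on p {..<n}" "i < n - 2"
  shows "card (window p i \<inter> X) =
    of_bool (p i \<in> X) + of_bool (p (i + 1) \<in> X) + of_bool (p (i + 2) \<in> X)"
proof -
  have "p i \<noteq> p (i + 1)" "p i \<noteq> p (i + 2)" "p (i + 1) \<noteq> p (i + 2)"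
    using assms by (auto simp: inj_on_eq_iff)
  then show ?thesis by (auto simp: window_def Int_insert_left)
qed

lemma card_window_Int_le: "card (window p i \<inter> X) \<le> 3"
proof -
  have "card (window p i \<inter> X) \<le> card (window p i)"
    by (intro card_mono) (auto simp: window_def)
  also have "\<dots> \<le> card {i, i + 1, i + 2}"
    unfolding window_eq_image by (intro card_image_le) auto
  finally show ?thesis by simp
qed

text \<open>Consecutive windows share two vertices: \<open>p i\<close> leaves and
  \<open>p (i + 3)\<close> enters.\<close>

lemma card_window_Int_step:
  assumes "inj_on p {..<n}" "Suc i < n - 2"
  shows "\<bar>int (card (window p (Suc i) \<inter> X)) - int (card (window p i \<inter> X))\<bar> \<le> 1"
proof -
  have "card (window p (Suc i) \<inter> X) + of_bool (p i \<in> X) =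
      card (window p i \<inter> X) + of_bool (p (i + 3) \<in> X)"
    using card_window_Int[OF assms(1), of i X] card_window_Int[OF assms(1), of "Suc i" X] assms(2)
    by (simp add: numeral_3_eq_3)
  then show ?thesis by (cases "p i \<in> X"; cases "p (i + 3) \<in> X") simp_all
qed

section \<open>From arrowing to paths in edge sets\<close>

lemma isomorphic_tight_path_windows:
  assumes "isomorphic (tight_path 3 n) S"
  obtains p where "inj_on p {..<n}" "window p ` {..<n - 2} \<subseteq> edges S"
proof -
  obtain f where f: "bij_betw f {1..n} (verts S)"
    and E: "(\<lambda>e. f ` e) ` edges (tight_path 3 n) = edges S"
    using assms by (auto simp: isomorphic_def tight_path_def)
  have "inj_on (\<lambda>i. f (i + 1)) {..<n}"
    using inj_onD[OF bij_betw_imp_inj_on[OF f]] by (fastforce intro!: inj_onI)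
  moreover have "window (\<lambda>i. f (i + 1)) i \<in> edges S" if "i < n - 2" for i
  proof -
    have "{i + 1..i + 1 + 3 - 1} \<in> edges (tight_path 3 n)"
      using that unfolding tight_path_def snd_conv by (intro CollectI exI[of _ "i + 1"]) simp
    moreover have "{i + 1..i + 1 + 3 - 1} = {i + 1, i + 2, i + 3}" by auto
    ultimately have "f ` {i + 1, i + 2, i + 3} \<in> edges S" using E by (metis imageI)
    moreover have "window (\<lambda>i. f (i + 1)) i = f ` {i + 1, i + 2, i + 3}"
      by (simp add: window_def numeral_3_eq_3)
    ultimately show ?thesis by simp
  qed
  ultimately show thesis by (intro that) auto
qed

text \<open>Use the colouring that is red exactly on \<open>A\<close>. The choices of
  \<open>A\<close> below are all edges, a path-free set, and a parity class.\<close>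

lemma arrows_tight_path_has_path:
  assumes "arrows G (tight_path 3 n)"
  shows "has_path n (edges G \<inter> A) \<or> has_path n (edges G - A)"
proof -
  obtain S col where S: "subhypergraph S G" "isomorphic (tight_path 3 n) S"
    and col: "\<forall>e\<in>edges S. (if e \<in> A then Red else Blue) = col"
    using assms[unfolded arrows_def, rule_format, of "\<lambda>e. if e \<in> A then Red else Blue"]
    by blast
  obtain p where "inj_on p {..<n}" "window p ` {..<n - 2} \<subseteq> edges S"
    using isomorphic_tight_path_windows[OF S(2)] .
  moreover have "edges S \<subseteq> edges G" using S(1) by (simp add: subhypergraph_def)
  moreover have "edges S \<subseteq> A \<or> edges S \<inter> A = {}"
    using col by (cases col) (auto split: if_splits)
  ultimately show ?thesis unfolding has_path_def by blast
qed

lemma arrows_card_ge_path_free: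
  assumes arr: "arrows G (tight_path 3 n)" and "finite (edges G)"
    and F: "F \<subseteq> edges G" "\<not> has_path n F"
  shows "card F + (n - 2) \<le> card (edges G)"
proof -
  have "has_path n (edges G - F)"
    using arrows_tight_path_has_path[OF arr, of F] F by (auto simp: Int_absorb1)
  then obtain p where p: "inj_on p {..<n}" "window p ` {..<n - 2} \<subseteq> edges G - F"
    by (auto simp: has_path_def)
  have "n - 2 \<le> card (edges G - F)"
    using card_mono[OF _ p(2)] card_windows[OF p(1)] assms(2) by simp
  moreover have "card F \<le> card (edges G)" using F assms(2) by (intro card_mono)
  ultimately show ?thesis
    using card_Diff_subset[of F "edges G"] F assms(2) by (auto dest: finite_subset)
qed

section \<open>Path-free unions\<close>

text \<open>The traces on \<open>X\<close> of an edge in \<open>P\<close> and an edge in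
  \<open>Q\<close> differ in size by at least two, so no path can switch between them. A path inside
  \<open>P\<close> would put \<open>n\<close> vertices into \<open>X\<close>; one inside
  \<open>Q\<close> would need \<open>n - 2\<close> edges.\<close>

lemma path_free_separated:
  assumes "finite X" "card X < n" "n \<ge> 3"
    and P: "\<And>e. e \<in> P \<Longrightarrow> card (e \<inter> X) = 3"
    and Q: "\<And>e. e \<in> Q \<Longrightarrow> card (e \<inter> X) \<le> 1" "finite Q" "card Q < n - 2"
  shows "\<not> has_path n (P \<union> Q)"
proof
  assume "has_path n (P \<union> Q)"
  then obtain p where p: "inj_on p {..<n}" and w: "\<And>i. i < n - 2 \<Longrightarrow> window p i \<in> P \<union> Q"
    by (auto simp: has_path_def)
  define s where "s i = card (window p i \<inter> X)" for i
  have s: "s i = 3 \<and> window p i \<in> P \<or> s i \<le> 1 \<and> window p i \<in> Q" if "i < n - 2" for i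
    using P Q(1) w[OF that] by (auto simp: s_def)
  have "s i = 3 \<longleftrightarrow> s 0 = 3" if "i < n - 2" for i
    using that
  proof (induction i)
    case (Suc i)
    have "\<bar>int (s (Suc i)) - int (s i)\<bar> \<le> 1"
      using card_window_Int_step[OF p Suc.prems] by (simp add: s_def)
    moreover have "s i = 3 \<or> s i \<le> 1" "s (Suc i) = 3 \<or> s (Suc i) \<le> 1"
      using s[of i] s[of "Suc i"] Suc.prems by auto
    ultimately have "s (Suc i) = 3 \<longleftrightarrow> s i = 3" by linarith
    with Suc show ?case by simp
  qed simp
  then consider "\<And>i. i < n - 2 \<Longrightarrow> s i = 3" | "\<And>i. i < n - 2 \<Longrightarrow> s i \<noteq> 3" by blast
  then show False
  proof cases
    case 1
    have "p j \<in> X" if "j < n" for j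
    proof -
      have in_X: "p i \<in> X \<and> p (i + 1) \<in> X \<and> p (i + 2) \<in> X" if "i < n - 2" for i
        using 1[OF that] card_window_Int[OF p that, of X]
        by (auto simp: s_def of_bool_def split: if_splits)
      show ?thesis
      proof (cases "j < n - 2")
        case False
        \<comment> \<open>No window starts at the last two positions; the last window, at
          \<open>n - 3\<close>, covers them.\<close>
        with that \<open>n \<ge> 3\<close> have "j = n - 3 + 1 \<or> j = n - 3 + 2" "n - 3 < n - 2" by auto
        with in_X[of "n - 3"] show ?thesis by auto
      qed (use in_X in blast)
    qed
    then have "n \<le> card X"
      using card_inj_on_le[OF p, of X] \<open>finite X\<close> by auto
    with \<open>card X < n\<close> show False by simp
  next
    case 2
    then have "window p ` {..<n - 2} \<subseteq> Q" using s by blast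
    then have "n - 2 \<le> card Q" using card_mono[OF \<open>finite Q\<close>] card_windows[OF p] by metis
    with Q(3) show False by simp
  qed
qed

text \<open>An inner vertex of a path lies in three of its edges, so thinning \<open>Q\<close> to degree at most two
  at the vertices outside \<open>X\<close> confines such vertices to the first two and last two positions.\<close>

lemma path_free_thinned:
  assumes "finite X" "card X + 3 < n"
    and P: "\<And>e. e \<in> P \<Longrightarrow> e \<subseteq> X"
    and P3: "\<And>e. e \<in> P \<Longrightarrow> card (e \<inter> X) \<ge> 2"
    and Q: "\<And>e. e \<in> Q \<Longrightarrow> card (e \<inter> X) \<ge> 2"
    and deg: "\<And>y. y \<notin> X \<Longrightarrow> finite {e \<in> Q. y \<in> e} \<and> card {e \<in> Q. y \<in> e} \<le> 2"
  shows "\<not> has_path n (P \<union> Q)"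
proof
  assume "has_path n (P \<union> Q)"
  then obtain p where p: "inj_on p {..<n}" and w: "\<And>i. i < n - 2 \<Longrightarrow> window p i \<in> P \<union> Q"
    by (auto simp: has_path_def)
  have inner: "p j \<in> X" if j: "2 \<le> j" "j < n - 2" for j
  proof (rule ccontr)
    assume y: "p j \<notin> X"
    have "window p i \<in> Q \<and> p j \<in> window p i" if "i \<in> {j - 2, j - 1, j}" for i
    proof -
      have "j \<in> {i, i + 1, i + 2}" using that j by auto
      then have "p j \<in> window p i" unfolding window_eq_image by blast
      moreover have "i < n - 2" using that j by auto
      ultimately show ?thesis using w P y by blast
    qed
    then have sub: "window p ` {j - 2, j - 1, j} \<subseteq> {e \<in> Q. p j \<in> e}" by blast
    have "card (window p ` {j - 2, j - 1, j}) = card {j - 2, j - 1, j}"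
      using j by (intro card_image inj_on_subset[OF inj_on_window[OF p]]) auto
    also have "\<dots> = 3"
    proof -
      have "j - 2 \<noteq> j - 1" "j - 2 \<noteq> j" "j - 1 \<noteq> j" using j by linarith+
      then show ?thesis by simp
    qed
    finally show False using card_mono[OF _ sub] deg[OF y] by simp
  qed
  \<comment> \<open>The inner positions already put \<open>n - 4\<close> vertices into
    \<open>X\<close>. The first edge meets \<open>X\<close> twice, so position 0 or 1 supplies one
    more, which is too many.\<close>
  have "card (window p 0 \<inter> X) \<ge> 2" using w[of 0] P3 Q \<open>card X + 3 < n\<close> by auto
  then have start: "p 0 \<in> X \<or> p 1 \<in> X"
    using card_window_Int[OF p, of 0 X] \<open>card X + 3 < n\<close> by (auto simp: of_bool_def split: if_splits)
  obtain k where k: "k < 2" "p k \<in> X" using start that[of 0] that[of 1] by auto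
  have sub: "p ` (insert k {2..<n - 2}) \<subseteq> X" using inner k by auto
  have "card (p ` (insert k {2..<n - 2})) = n - 3"
    using k \<open>card X + 3 < n\<close> by (subst card_image[OF inj_on_subset[OF p]]) auto
  then show False using card_mono[OF \<open>finite X\<close> sub] \<open>card X + 3 < n\<close> by simp
qed

text \<open>The vertex \<open>p j\<close> lies only in windows starting at \<open>j - 2\<close>,
  \<open>j - 1\<close> or \<open>j\<close>, and one of three consecutive indices is 2 modulo
  3.\<close>

lemma card_thinned_windows_containing:
  assumes p: "inj_on p {..<n}"
  shows "card {e \<in> window p ` {i. i < n - 2 \<and> i mod 3 \<noteq> 2}. y \<in> e} \<le> 2"
proof (cases "y \<in> p ` {..<n}")
  case True
  then obtain j where j: "j < n" "y = p j" by auto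
  let ?I = "{i. i mod 3 \<noteq> 2 \<and> i \<in> {j - 2..j}}"
  have sub: "{e \<in> window p ` {i. i < n - 2 \<and> i mod 3 \<noteq> 2}. y \<in> e} \<subseteq> window p ` ?I"
  proof
    fix e assume "e \<in> {e \<in> window p ` {i. i < n - 2 \<and> i mod 3 \<noteq> 2}. y \<in> e}"
    then obtain i where i: "i < n - 2" "i mod 3 \<noteq> 2" "e = window p i" "p j \<in> window p i"
      using j by auto
    moreover have "{i, i + 1, i + 2} \<subseteq> {..<n}" using i by auto
    ultimately have "j \<in> {i, i + 1, i + 2}"
      using inj_on_image_mem_iff[OF p, of j "{i, i + 1, i + 2}"] j unfolding window_eq_image by blast
    then show "e \<in> window p ` ?I" using i by auto
  qed
  have "card ?I \<le> 2"
  \<comment> \<open>Near the start \<open>j - 2\<close> truncates to 0, and at most two windows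
    contain \<open>p j\<close> anyway.\<close>
  proof (cases "j < 2")
    case True
    then have "?I \<subseteq> {0, 1}" by auto
    then show ?thesis using card_mono[of "{0, 1::nat}" ?I] by simp
  next
    case False
    then have "\<exists>i. j - 2 \<le> i \<and> i \<le> j \<and> i mod 3 = 2" by presburger
    then obtain i where i: "i \<in> {j - 2..j}" "i mod 3 = 2" by auto
    then have "?I \<subseteq> {j - 2..j} - {i}" by auto
    then have "card ?I \<le> card ({j - 2..j} - {i})" by (intro card_mono) auto
    then show ?thesis using i False by simp
  qed
  then show ?thesis using surj_card_le[OF _ sub] by simp
next
  case False
  then have "{e \<in> window p ` {i. i < n - 2 \<and> i mod 3 \<noteq> 2}. y \<in> e} = {}"
    by (auto simp: window_def)
  then show ?thesis by (metis card.empty zero_le)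
qed

text \<open>The omitted indices are \<open>3 * k + 2\<close> with \<open>k < m div 3\<close>.
  Omitting residue 0 instead would lose one more index whenever 3 does not divide
  \<open>m\<close>.\<close>

lemma card_mod_3_neq_2: "m - m div 3 \<le> card {i. i < m \<and> i mod 3 \<noteq> (2::nat)}"
proof -
  let ?A = "{i. i < m \<and> i mod 3 \<noteq> (2::nat)}" and ?B = "(\<lambda>k. 3 * k + 2) ` {..<m div 3}"
  have "i \<in> ?A \<union> ?B" if "i < m" for i
  proof (cases "i mod 3 = 2")
    case True
    then have i: "i = 3 * (i div 3) + 2" using mult_div_mod_eq[of 3 i] by simp
    then have "Suc (i div 3) * 3 \<le> m" using that by simp
    then have "i div 3 < m div 3" by (simp add: less_eq_div_iff_mult_less_eq flip: Suc_le_eq)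
    with i show ?thesis by blast
  qed (use that in simp)
  then have "card {..<m} \<le> card (?A \<union> ?B)" by (intro card_mono) auto
  also have "\<dots> \<le> card ?A + card ?B" by (rule card_Un_le)
  also have "card ?B \<le> m div 3" using card_image_le[of "{..<m div 3}"] by simp
  finally show ?thesis by simp
qed

section \<open>The lower bound for every host\<close>

lemma arrows_tight_path_card_ge:
  fixes G :: "'a hypergraph"
  assumes n: "n \<ge> 7" and G: "kgraph 3 G" and arr: "arrows G (tight_path 3 n)"
  shows "8 * n \<le> 3 * card (edges G) + 28"
proof -
  have finE: "finite (edges G)"
    using G by (auto simp: kgraph_def finite_imp_finite_nsets intro: finite_subset)
  have "\<not> has_path n ({} :: 'a set set)" using n by (auto simp: has_path_def lessThan_empty_iff)
  \<comment> \<open>With every edge red, the blue class is empty, so \<open>G\<close> itself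
    contains a path.\<close>
  then obtain p where p: "inj_on p {..<n}" and pE: "window p ` {..<n - 2} \<subseteq> edges G"
    using arrows_tight_path_has_path[OF arr, of UNIV] by (auto simp: has_path_def)
  \<comment> \<open>The size \<open>n - 4\<close> is the largest that
    \<open>path_free_thinned\<close> allows. Windows inside \<open>X\<close> then start below
    \<open>n - 6\<close>.\<close>
  define X where "X = p ` {..<n - 4}"
  define P where "P = window p ` {..<n - 6}"
  have finX: "finite X" by (simp add: X_def)
  have cardX: "card X = n - 4"
    unfolding X_def by (subst card_image[OF inj_on_subset[OF p]]) auto
  have PE: "P \<subseteq> edges G" using pE by (auto simp: P_def)
  have PX: "e \<subseteq> X" if "e \<in> P" for e
    using that by (auto simp: P_def X_def window_def)
  have P3: "card (e \<inter> X) = 3" if e: "e \<in> P" for e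
  proof -
    obtain i where i: "e = window p i" "i < n - 6" using e unfolding P_def by blast
    then have "p i \<in> X" "p (i + 1) \<in> X" "p (i + 2) \<in> X" by (auto simp: X_def)
    then show ?thesis using card_window_Int[OF p, of i X] i by simp
  qed
  have cardP: "card P = n - 6" "finite P"
    unfolding P_def by (subst card_image[OF inj_on_subset[OF inj_on_window[OF p]]]) auto

  let ?A = "{e. even (card (e \<inter> X))}" and ?I = "{..<n - 2}"
  obtain q where q: "inj_on q {..<n}"
    and split: "window q ` ?I \<subseteq> edges G \<inter> ?A \<or> window q ` ?I \<subseteq> edges G - ?A"
    using arrows_tight_path_has_path[OF arr, of ?A] unfolding has_path_def by metis
  have qE: "window q ` ?I \<subseteq> edges G" using split by blast
  have par: "even (card (window q i \<inter> X)) \<longleftrightarrow> even (card (window q j \<inter> X))"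
    if "i < n - 2" "j < n - 2" for i j
    using split that by (elim disjE) blast+
  have parity: "x = y" if "even x \<longleftrightarrow> even y" "\<bar>int x - int y\<bar> \<le> 1" for x y :: nat
    using that by presburger
  define c where "c = card (window q 0 \<inter> X)"
  have c: "card (window q i \<inter> X) = c" if "i < n - 2" for i
    using that
  proof (induction i)
    case (Suc i)
    have "even (card (window q (Suc i) \<inter> X)) \<longleftrightarrow> even (card (window q i \<inter> X))"
      using par[of "Suc i" i] Suc.prems by linarith
    then have "card (window q (Suc i) \<inter> X) = card (window q i \<inter> X)"
      using card_window_Int_step[OF q Suc.prems] by (rule parity)
    with Suc show ?case by simp
  qed (simp add: c_def)
  have "c \<le> 3" unfolding c_def by (rule card_window_Int_le)
  moreover have "c \<noteq> 3"
  proof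
    assume "c = 3"
    \<comment> \<open>With an empty second class, separation just says that \<open>n\<close> path
      vertices do not fit into \<open>X\<close>.\<close>
    then have "\<not> has_path n (window q ` {..<n - 2} \<union> {})"
      using finX cardX n c by (intro path_free_separated[of X]) auto
    then show False using q by (auto simp: has_path_def)
  qed
  ultimately consider "c \<le> 1" | "c = 2" by linarith
  then show ?thesis
  proof cases
    case 1
    define Q where "Q = window q ` {..<n - 3}"
    have cardQ: "card Q = n - 3" "finite Q"
      unfolding Q_def by (subst card_image[OF inj_on_subset[OF inj_on_window[OF q]]]) auto
    have Q1: "card (e \<inter> X) \<le> 1" if "e \<in> Q" for e using that c 1 by (auto simp: Q_def)
    have "\<not> has_path n (P \<union> Q)"
      using finX cardX cardQ n P3 Q1 by (intro path_free_separated[of X]) auto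
    moreover have "P \<union> Q \<subseteq> edges G" using PE qE by (auto simp: Q_def)
    moreover have "card (P \<union> Q) = card P + card Q"
      using P3 Q1 cardP cardQ by (intro card_Un_disjoint) fastforce+
    \<comment> \<open>The count is \<open>(n - 6) + (n - 3) + (n - 2) = 3 * n - 11\<close>, more
      than enough here.\<close>
    ultimately show ?thesis
      using arrows_card_ge_path_free[OF arr finE, of "P \<union> Q"] cardP cardQ n by simp
  next
    case 2
    define Q where "Q = window q ` {i. i < n - 2 \<and> i mod 3 \<noteq> 2}"
    have cardQ: "card Q = card {i. i < n - 2 \<and> i mod 3 \<noteq> 2}" "finite Q"
      unfolding Q_def by (subst card_image[OF inj_on_subset[OF inj_on_window[OF q]]]) auto
    have Q2: "card (e \<inter> X) = 2" if "e \<in> Q" for e using that c 2 by (auto simp: Q_def)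
    have "\<not> has_path n (P \<union> Q)"
    proof (rule path_free_thinned[OF finX])
      fix y
      show "finite {e \<in> Q. y \<in> e} \<and> card {e \<in> Q. y \<in> e} \<le> 2"
        using card_thinned_windows_containing[OF q, of y] cardQ(2) by (auto simp: Q_def)
    qed (use cardX n PX P3 Q2 in auto)
    moreover have "P \<union> Q \<subseteq> edges G" using PE qE by (auto simp: Q_def)
    moreover have "card (P \<union> Q) = card P + card Q"
      using P3 Q2 cardP cardQ by (intro card_Un_disjoint) fastforce+
    ultimately have "n - 6 + card Q + (n - 2) \<le> card (edges G)"
      using arrows_card_ge_path_free[OF arr finE, of "P \<union> Q"] cardP by simp
    \<comment> \<open>This case determines the constant:
      \<open>3 * (n - 6) + 2 * (n - 2) + 3 * (n - 2) = 8 * n - 28\<close>.\<close>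
    moreover have "2 * (n - 2) \<le> 3 * card Q"
      using card_mod_3_neq_2[of "n - 2"] div_times_less_eq_dividend[of "n - 2" 3]
      unfolding cardQ(1) by linarith
    ultimately show ?thesis using n by linarith
  qed
qed

section \<open>Existence of a host and the final bound\<close>

text \<open>Ensures that the infimum in \<open>size_ramsey\<close> is attained and is not the
  default 0 of the empty set. By Ramsey's theorem a large complete 3-graph has a homogeneous
  \<open>n\<close>-set, which carries a copy of the path.\<close>

lemma ex_arrows_tight_path:
  "\<exists>G :: nat hypergraph. kgraph 3 G \<and> arrows G (tight_path 3 n)"
proof -
  obtain N :: nat where N: "partn_lst {..<N} [n, n] 3" using ramsey_full by blast
  let ?G = "({..<N}, nsets {..<N} 3)"
  have "arrows ?G (tight_path 3 n)"
    unfolding arrows_def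
  proof
    fix c :: "nat set \<Rightarrow> color"
    define f where "f e = (if c e = Red then 0 else 1 :: nat)" for e
    have "f \<in> nsets {..<N} 3 \<rightarrow> {..<length [n, n]}" by (auto simp: f_def)
    then obtain i H where i: "i < 2" and H: "H \<in> nsets {..<N} ([n, n] ! i)"
      and mono: "f ` nsets H 3 \<subseteq> {i}"
      using partn_lstE[OF N, of f 2] by (auto simp: numeral_2_eq_2)
    have H': "H \<subseteq> {..<N}" "finite H" "card H = n"
      using H i by (auto simp: nsets_def less_2_cases_iff)
    obtain g where g: "bij_betw g {1..n} H"
      using H' finite_same_card_bij[of "{1..n}" H] by auto
    let ?S = "(H, (\<lambda>e. g ` e) ` edges (tight_path 3 n))"
    have SE: "edges ?S \<subseteq> nsets H 3"
    proof
      fix e assume "e \<in> edges ?S"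
      then obtain d where d: "d \<in> nsets {1..n} 3" "e = g ` d"
        using kgraph_tight_path[of 3 n] by (auto simp: kgraph_def tight_path_def)
      then have "card e = 3"
        using card_image[OF inj_on_subset[OF bij_betw_imp_inj_on[OF g]]] by (auto simp: nsets_def)
      then show "e \<in> nsets H 3"
        using d g by (auto simp: nsets_def bij_betw_def)
    qed
    have "subhypergraph ?S ?G"
      using H' SE nsets_mono[of H "{..<N}" 3] by (auto simp: subhypergraph_def)
    moreover have "isomorphic (tight_path 3 n) ?S"
      using g by (auto simp: isomorphic_def tight_path_def)
    moreover have "\<forall>e\<in>edges ?S. c e = (if i = 0 then Red else Blue)"
    proof
      fix e assume "e \<in> edges ?S"
      then have "f e = i" using SE mono by blast
      then show "c e = (if i = 0 then Red else Blue)"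
        by (cases "c e") (auto simp: f_def split: if_splits)
    qed
    ultimately show "\<exists>S col. subhypergraph S ?G \<and> isomorphic (tight_path 3 n) S \<and>
        (\<forall>e\<in>edges S. c e = col)" by blast
  qed
  then show ?thesis by (intro exI[of _ ?G]) (simp add: kgraph_def)
qed

theorem theorem2:
  fixes n :: nat
  assumes "n \<ge> 7"
  shows "real (size_ramsey 3 (tight_path 3 n)) \<ge> 8 / 3 * real n - 28 / 3"
proof -
  let ?M = "{m. \<exists>G :: nat hypergraph. kgraph 3 G \<and> card (edges G) = m \<and>
    arrows G (tight_path 3 n)}"
  have "?M \<noteq> {}" using ex_arrows_tight_path by blast
  then have "size_ramsey 3 (tight_path 3 n) \<in> ?M"
    unfolding size_ramsey_def by (rule Inf_nat_def1)
  then have "8 * n \<le> 3 * size_ramsey 3 (tight_path 3 n) + 28"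
    using arrows_tight_path_card_ge[OF assms] by fastforce
  then have "real (8 * n) \<le> real (3 * size_ramsey 3 (tight_path 3 n) + 28)"
    by (simp only: of_nat_le_iff)
  then show ?thesis by simp
qed

end
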